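(* For every integer $n\ge 1$, \[ \binom{n+1}{2}F_n(z)=\sum_{\substack{1\le k\le n+1\\ k\equiv n \pmod 2}} {n+1\brack k}\, z^{\lfloor (k-1)/2\rfloor}. \]
   Context: $\mathfrak{S}_n$ is the symmetric group on $\{1,\dots,n\}$, $Q_n\subseteq\mathfrak{S}_n$ is the set of $n$-cycles, and $c(\eta)$ denotes the number of cycles (including fixed points) of a permutation $\eta$. Permutations are multiplied from left to right. For $\pi\in\mathfrak{S}_n$, $F_\pi(z)=\sum_{\zeta\in Q_n} z^{\lfloor (c(\zeta\pi)-1)/2\rfloor}$; this depends only on the cycle type of $\pi$. $F_n(z)$ denotes $F_\pi(z)$ for $\pi$ an $n$-cycle (e.g. $\pi=(1\,2\,\cdots\,n)$). ${m\brack k}$ denotes the signless Stirling number of the first kind, the number of permutations in $\mathfrak{S}_m$ with exactly $k$ cycles. *)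

theory Defs
  imports
    "HOL-Combinatorics.Orbits"
    "HOL-Combinatorics.Cycles"
    "HOL-Combinatorics.Stirling"
    "HOL-Computational_Algebra.Polynomial"
begin

text \<open>Fixed points are counted, since the orbit of a fixed point \<open>x\<close> is \<open>{x}\<close>.\<close>

definition num_cycles :: "'a set \<Rightarrow> ('a \<Rightarrow> 'a) \<Rightarrow> nat" where
  "num_cycles S p = card (orbit p ` S)"

definition n_cycles :: "nat \<Rightarrow> (nat \<Rightarrow> nat) set" where
  "n_cycles n = {p. p permutes {1..n} \<and> cyclic_on p {1..n}}"

text \<open>Permutations are multiplied from left to right, so the product of \<open>\<zeta>\<close> and \<open>\<pi>\<close>
  (in this order) is the function \<open>\<pi> \<circ> \<zeta>\<close>.\<close>

definition F_poly :: "nat \<Rightarrow> (nat \<Rightarrow> nat) \<Rightarrow> int poly" where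
  "F_poly n \<pi> = (\<Sum>\<zeta>\<in>n_cycles n. monom 1 ((num_cycles {1..n} (\<pi> \<circ> \<zeta>) - 1) div 2))"

text \<open>The standard cycle \<open>(1 2 \<dots> n)\<close> is an \<open>n\<close>-cycle in the above sense.\<close>

lemma cycle_of_list_in_n_cycles:
  assumes "n \<ge> 1"
  shows "cycle_of_list [1..<Suc n] \<in> n_cycles n"
proof -
  let ?c = "cycle_of_list [1..<Suc n]"
  have set: "set [1..<Suc n] = {1..n}" by auto
  have perm: "?c permutes {1..n}" using cycle_permutes[of "[1..<Suc n]"] set by simp
  have pow: "(?c ^^ k) 1 = Suc k" if "k < n" for k
  proof -
    have "map (?c ^^ k) [1..<Suc n] ! 0 = rotate k [1..<Suc n] ! 0"
      by (subst cyclic_rotation) simp_all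
    then show ?thesis using that by (simp add: nth_rotate del: upt_Suc)
  qed
  have "y \<in> orbit ?c 1" if "y \<in> {1..n}" for y
  proof -
    have "permutation ?c" by (rule permutation_of_cycle)
    moreover have "y = (?c ^^ (y - 1)) 1" using pow[of "y - 1"] that by auto
    ultimately show ?thesis unfolding orbit_altdef_permutation[OF permutation_of_cycle] by blast
  qed
  moreover have "orbit ?c 1 \<subseteq> {1..n}" using permutes_orbit_subset[OF perm] assms by auto
  ultimately have "{1..n} = orbit ?c 1" by blast
  then show ?thesis using perm assms unfolding n_cycles_def cyclic_on_def by auto
qed

text \<open>The library introduces \<^const>\<open>stirling\<close> by its recurrence. The following lemmas show that
  \<open>stirling m k\<close> is the number of permutations in \<open>\<SS>\<^sub>m\<close> with exactly \<open>k\<close> cycles.\<close>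

lemma orbit_transpose_comp:
  assumes q: "q permutes S" and a: "a \<notin> S" and b: "b \<in> S" and x: "x \<in> S"
  shows "orbit (transpose a b \<circ> q) x = (if b \<in> orbit q x then insert a (orbit q x) else orbit q x)"
    (is "orbit ?f x = ?R")
proof -
  have qa: "q a = a" using q a by (simp add: permutes_not_in)
  have ab: "a \<noteq> b" using a b by auto
  have fa: "?f a = b" using qa by simp
  have inS: "y \<in> S" if "y \<in> orbit q x" for y using permutes_orbit_subset[OF q x] that by auto
  have f: "?f y = (if q y = b then a else q y)" if "y \<in> S" for y
    using permutes_in_image[OF q, of y] that a by (auto simp: transpose_def)
  have R1: "?f y \<in> ?R" if "q y \<in> orbit q x" "y \<in> S" for y
    using that f[of y] by auto
  have R2: "y \<in> ?R" if "y \<in> orbit ?f x" for y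
    using that
  proof induction
    case base
    show ?case using R1[OF orbit.base x] .
  next
    case (step y)
    show ?case
    proof (cases "y = a")
      case True
      then have "b \<in> orbit q x" using step.IH inS a by (auto split: if_splits)
      then show ?thesis using True fa by simp
    next
      case False
      then have "y \<in> orbit q x" using step.IH by (auto split: if_splits)
      then show ?thesis by (intro R1 orbit.step inS)
    qed
  qed
  have L1: "q y \<in> orbit ?f x \<and> (q y = b \<longrightarrow> a \<in> orbit ?f x)"
    if "y \<in> S" "?f y \<in> orbit ?f x" for y
  proof (cases "q y = b")
    case True
    then have "a \<in> orbit ?f x" using that f by auto
    then show ?thesis using orbit.step[of a ?f x] fa True by auto
  next
    case False
    then show ?thesis using that f by auto
  qed
  have L2: "y \<in> orbit ?f x \<and> (y = b \<longrightarrow> a \<in> orbit ?f x)" if "y \<in> orbit q x" for y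
    using that
  proof induction
    case base
    show ?case using L1[OF x orbit.base] .
  next
    case (step y)
    then show ?case by (intro L1 inS orbit.step) auto
  qed
  show ?thesis
  proof (intro equalityI subsetI)
    show "y \<in> ?R" if "y \<in> orbit ?f x" for y using R2[OF that] .
    show "y \<in> orbit ?f x" if "y \<in> ?R" for y using that L2 by (auto split: if_splits)
  qed
qed

lemma num_cycles_insert_fixed:
  assumes "finite S" "q permutes S" "a \<notin> S"
  shows "num_cycles (insert a S) q = Suc (num_cycles S q)"
proof -
  have "orbit q a = {a}" using assms by (simp add: orbit_eq_singleton_iff permutes_not_in)
  moreover have "{a} \<notin> orbit q ` S"
    using permutes_orbit_subset[OF assms(2)] assms(3) by blast
  ultimately show ?thesis using assms(1) by (simp add: num_cycles_def)
qed

lemma num_cycles_insert_transpose: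
  assumes S: "finite S" and q: "q permutes S" and a: "a \<notin> S" and b: "b \<in> S"
  shows "num_cycles (insert a S) (transpose a b \<circ> q) = num_cycles S q"
proof -
  let ?f = "transpose a b \<circ> q"
  let ?g = "\<lambda>A. if b \<in> A then insert a A else A"
  have "?f permutes insert a S"
    using permutes_compose[OF permutes_subset[OF q] permutes_swap_id[of a _ b]] b by auto
  then have "permutation ?f" using S by (auto simp: permutation_permutes)
  moreover have "?f a = b" using q a by (simp add: permutes_not_in)
  ultimately have "orbit ?f a = orbit ?f b" using permutation_orbit_step by metis
  then have "orbit ?f ` insert a S = orbit ?f ` S" using b by auto
  also have "\<dots> = ?g ` (orbit q ` S)"
    unfolding image_image using orbit_transpose_comp[OF q a b] by (intro image_cong) auto
  finally have "orbit ?f ` insert a S = ?g ` (orbit q ` S)" .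
  moreover have "inj_on ?g (orbit q ` S)"
  proof (rule inj_onI)
    fix A B assume "A \<in> orbit q ` S" "B \<in> orbit q ` S" and eq: "?g A = ?g B"
    then have "a \<notin> A" "a \<notin> B" using permutes_orbit_subset[OF q] a by blast+
    then show "A = B" using eq by (auto split: if_splits)
  qed
  ultimately show ?thesis unfolding num_cycles_def by (simp only: card_image)
qed

lemma card_permutes_num_cycles:
  assumes "finite S"
  shows "card {p. p permutes S \<and> num_cycles S p = k} = stirling (card S) k"
  using assms
proof (induction S arbitrary: k rule: finite_induct)
  case empty
  have "{p::'a \<Rightarrow> 'a. p permutes {} \<and> num_cycles {} p = k} = (if k = 0 then {id} else {})"
    by (auto simp: num_cycles_def)
  then show ?case by (cases k) auto
next
  case (insert a S)
  let ?P = "\<lambda>k. {p. p permutes S \<and> num_cycles S p = k}"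
  let ?h = "\<lambda>(b, p). transpose a b \<circ> p"
  let ?A = "{q. q permutes S \<and> Suc (num_cycles S q) = k}"
  have fin: "finite (?P j)" for j
    by (rule finite_subset[OF _ finite_permutations[OF insert.hyps(1)]]) auto
  have num: "num_cycles (insert a S) (transpose a b \<circ> q) =
      (if b = a then Suc (num_cycles S q) else num_cycles S q)"
    if "b \<in> insert a S" "q permutes S" for b q
    using that insert.hyps num_cycles_insert_fixed[of S q a] num_cycles_insert_transpose[of S q a b]
    by auto
  have inj: "inj_on ?h (insert a S \<times> {p. p permutes S})"
  proof (rule inj_onI, clarify)
    fix b q b' q'
    assume q: "q permutes S" "q' permutes S" and eq: "transpose a b \<circ> q = transpose a b' \<circ> q'"
    have "q a = a" "q' a = a" using q insert.hyps by (auto simp: permutes_not_in)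
    then have bb: "b = b'" using fun_cong[OF eq, of a] by simp
    have "transpose a b \<circ> (transpose a b \<circ> q) = transpose a b \<circ> (transpose a b \<circ> q')"
      using eq bb by simp
    then have "q = q'" by (simp add: fun_eq_iff)
    then show "b = b' \<and> q = q'" using bb by simp
  qed
  have "{p. p permutes insert a S \<and> num_cycles (insert a S) p = k} = ?h ` ({a} \<times> ?A \<union> S \<times> ?P k)"
    (is "?L = ?R")
  proof
    show "?L \<subseteq> ?R"
    proof
      fix p assume p: "p \<in> ?L"
      then have "p \<in> {p. p permutes insert a S}" by simp
      then obtain b q where bq: "b \<in> insert a S" "q permutes S" "p = transpose a b \<circ> q"
        unfolding permutes_insert by auto
      then have "(b, q) \<in> {a} \<times> ?A \<union> S \<times> ?P k"
        using num[OF bq(1,2)] p by (auto split: if_splits)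
      then show "p \<in> ?R" using bq(3) by (intro image_eqI[of _ _ "(b, q)"]) auto
    qed
    show "?R \<subseteq> ?L"
    proof
      fix p assume "p \<in> ?R"
      then obtain b q where bq: "(b, q) \<in> {a} \<times> ?A \<union> S \<times> ?P k" "p = transpose a b \<circ> q" by auto
      then have bS: "b \<in> insert a S" "q permutes S" by auto
      have "p permutes insert a S" using bS bq(2) permutes_insert[of a S] by auto
      moreover have "num_cycles (insert a S) p = k"
        using num[OF bS] bq insert.hyps by auto
      ultimately show "p \<in> ?L" by simp
    qed
  qed
  moreover have "inj_on ?h ({a} \<times> ?A \<union> S \<times> ?P k)" by (rule inj_on_subset[OF inj]) auto
  ultimately have "card {p. p permutes insert a S \<and> num_cycles (insert a S) p = k} =
      card ({a} \<times> ?A \<union> S \<times> ?P k)"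
    by (simp add: card_image)
  also have "\<dots> = card ({a} \<times> ?A) + card (S \<times> ?P k)"
  proof (rule card_Un_disjoint)
    show "finite ({a} \<times> ?A)"
      by (intro finite_cartesian_product finite_subset[OF _ finite_permutations[OF insert.hyps(1)]]) auto
  qed (use fin insert.hyps in auto)
  also have "\<dots> = card ?A + card S * stirling (card S) k"
    by (simp add: card_cartesian_product insert.IH)
  also have "\<dots> = stirling (card (insert a S)) k"
  proof (cases k)
    case 0
    then show ?thesis using insert.hyps by (cases "card S") auto
  next
    case (Suc j)
    then show ?thesis using insert.hyps insert.IH[of j] by simp
  qed
  finally show ?case .
qed

corollary stirling_eq_card:
  "stirling m k = card {p. p permutes {1..m} \<and> num_cycles {1..m} p = k}"
  using card_permutes_num_cycles[of "{1..m}" k] by simp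

end

theory Submission
  imports Defs
begin

text \<open>
  Fix \<open>r \<in> U\<close>. By inclusion-exclusion over the cycles of \<open>\<zeta>\<close> avoiding \<open>r\<close>, the indicator of
  \<open>\<zeta>\<close> being a full cycle is the sum of \<open>(-1)\<close> to the number of cycles of \<open>\<zeta>\<close> in \<open>S\<close>, over
  the \<open>\<zeta>\<close>-invariant sets \<open>S\<close> avoiding \<open>r\<close>. A permutation leaving \<open>S\<close> invariant is a pair of
  permutations \<open>\<beta>\<close> of \<open>S\<close> and \<open>\<gamma>\<close> of \<open>U - S\<close>, so the generating function of the cycle numbers of
  \<open>\<pi> \<circ> \<zeta>\<close> is an alternating sum over \<open>S\<close> of the sums of \<open>sign \<beta> * x ^ c(\<pi> \<circ> \<beta> \<circ> \<gamma>)\<close>.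
  If two points of \<open>S\<close> leave \<open>S\<close> under \<open>\<pi>\<close>, swapping them reverses the sign and preserves the
  cycle type up to a substitution in \<open>\<gamma>\<close>, so the sum for \<open>S\<close> vanishes. There remain the empty set
  and the \<open>n - s\<close> arcs of each length \<open>s\<close> on the cycle \<open>\<pi>\<close>, for which the sum is a product of
  consecutive linear factors. Telescoping twice gives
  \<open>n (n + 1) \<Sum>\<zeta>. x ^ c(\<pi> \<circ> \<zeta>) = x (x + 1) \<dots> (x + n) - x (x - 1) \<dots> (x - n)\<close>,
  whose coefficients are twice the Stirling numbers with \<open>k \<equiv> n\<close> modulo 2, and zero otherwise.
\<close>

section \<open>Signed cycle sums and cycle counts of products\<close>

text \<open>In the application \<open>C\<close> is the complement of \<open>S\<close>, and
  \<open>\<beta> \<circ> \<gamma>\<close> runs over the permutations leaving \<open>S\<close>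
  invariant. Keeping \<open>S\<close> and \<open>C\<close> as separate arguments lets either grow by
  one point in an induction.\<close>

definition signed_cycle_sum :: "'b::comm_ring_1 \<Rightarrow> ('a \<Rightarrow> 'a) \<Rightarrow> 'a set \<Rightarrow> 'a set \<Rightarrow> 'b" where
  "signed_cycle_sum x \<rho> S C =
    (\<Sum>\<beta> | \<beta> permutes S. \<Sum>\<gamma> | \<gamma> permutes C.
      of_int (sign \<beta>) * x ^ num_cycles (S \<union> C) (\<rho> \<circ> \<beta> \<circ> \<gamma>))"

lemma comp_transpose:
  assumes "inj p"
  shows "p \<circ> transpose a b = transpose (p a) (p b) \<circ> p"
  using assms by (auto simp: fun_eq_iff transpose_def dest: injD)

text \<open>Moving the transposition to the left of \<open>p\<close> turns it into
  \<open>transpose a (p b)\<close>, since \<open>p\<close> fixes \<open>a\<close>. It then splices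
  \<open>a\<close> into an existing cycle of \<open>p \<circ> q\<close>.\<close>

lemma num_cycles_comp_transpose_fixed:
  assumes "finite U" "p permutes U" "q permutes U" "a \<notin> U" "b \<in> U"
  shows "num_cycles (insert a U) (p \<circ> transpose a b \<circ> q) = num_cycles U (p \<circ> q)"
proof -
  have "p \<circ> transpose a b \<circ> q = transpose a (p b) \<circ> (p \<circ> q)"
    using comp_transpose[OF permutes_inj[OF assms(2)], of a b] permutes_not_in[OF assms(2,4)]
    by (simp add: o_assoc)
  then show ?thesis
    using num_cycles_insert_transpose[of U "p \<circ> q" a "p b"] assms permutes_in_image[OF assms(2)]
    by (simp add: permutes_compose)
qed

text \<open>The map \<open>u\<close> carries the \<open>p\<close>-orbit of \<open>y\<close> onto the
  \<open>q\<close>-orbit of \<open>u y\<close>, so it induces a bijection between the two sets of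
  orbits.\<close>

lemma num_cycles_conjugate:
  assumes "inj_on u U" "u ` U = U" "p permutes U" "finite U" "\<And>y. y \<in> U \<Longrightarrow> q (u y) = u (p y)"
  shows "num_cycles U q = num_cycles U p"
proof -
  have "u ` orbit p y = orbit q (u y)" if "y \<in> U" for y
  proof (rule orbit_inverse)
    show "y \<in> orbit p y"
      using assms by (auto intro!: permutation_self_in_orbit simp: permutation_permutes)
    show "q (u z) = u (p z)" if "z \<in> orbit p y" for z
      using permutes_orbit_subset[OF assms(3) \<open>y \<in> U\<close>] that assms(5) by auto
  qed
  then have "(`) u ` orbit p ` U = orbit q ` u ` U"
    by (auto simp: image_image intro!: image_cong)
  moreover have "inj_on ((`) u) (orbit p ` U)"
  proof (rule inj_onI)
    fix A B assume *: "A \<in> orbit p ` U" "B \<in> orbit p ` U" "u ` A = u ` B"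
    then have "A \<subseteq> U" "B \<subseteq> U" using permutes_orbit_subset[OF assms(3)] by auto
    then show "A = B" using *(3) inj_on_image_eq_iff[OF assms(1)] by blast
  qed
  ultimately show ?thesis
    unfolding num_cycles_def using assms(2) card_image by metis
qed

text \<open>The permutation \<open>p\<close> itself conjugates \<open>q \<circ> p\<close> to
  \<open>p \<circ> q\<close>.\<close>

lemma num_cycles_comp_commute:
  assumes "finite U" "p permutes U" "q permutes U"
  shows "num_cycles U (p \<circ> q) = num_cycles U (q \<circ> p)"
  by (rule num_cycles_conjugate[where u = p])
    (use assms permutes_image[of p U] in \<open>auto simp: permutes_compose permutes_inj_on\<close>)

text \<open>Adding a fixed point raises both the size and the cycle count; splicing a point into a
  cycle raises only the size and flips the sign. This converts the inclusion-exclusion weight into a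
  sign.\<close>

lemma sign_eq_num_cycles:
  assumes "finite S" "p permutes S"
  shows "sign p = (-1) ^ (card S + num_cycles S p)"
  using assms
proof (induction S arbitrary: p rule: finite_induct)
  case empty
  then show ?case by (simp add: num_cycles_def)
next
  case (insert a S)
  have "p \<in> {p. p permutes insert a S}" using insert.prems by simp
  then obtain b q where bq: "b \<in> insert a S" "q permutes S" "p = transpose a b \<circ> q"
    unfolding permutes_insert by auto
  have "permutation q" using bq insert.hyps by (auto simp: permutation_permutes)
  then have "sign p = sign (transpose a b) * sign q"
    by (simp add: bq sign_compose permutation_swap_id)
  then show ?case
    using insert.IH[OF bq(2)] insert.hyps bq(1,2) num_cycles_insert_fixed[of S q a]
      num_cycles_insert_transpose[of S q a b]
    unfolding bq(3) by (auto simp: sign_swap_id simp del: o_apply)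
qed

section \<open>Recurrences, translation and vanishing of signed cycle sums\<close>

text \<open>Each permutation of \<open>insert a C\<close> is uniquely
  \<open>transpose a b \<circ> \<gamma>\<close> with \<open>\<gamma>\<close> permuting
  \<open>C\<close>. Since \<open>\<rho>\<close> fixes \<open>a\<close>, the choice
  \<open>b = a\<close> adds a cycle and gives the factor \<open>x\<close>, while each
  \<open>b\<close> in \<open>C\<close> preserves the cycle count and reproduces the old sum.\<close>

lemma signed_cycle_sum_insert_right:
  assumes "finite S" "finite C" "S \<inter> C = {}" "\<rho> permutes S \<union> C" "a \<notin> S \<union> C"
  shows "signed_cycle_sum x \<rho> S (insert a C) = (x + of_nat (card C)) * signed_cycle_sum x \<rho> S C"
proof -
  let ?P = "\<lambda>A. {p. p permutes A}"
  let ?U = "S \<union> C"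
  have "(\<Sum>\<gamma>\<in>?P (insert a C). of_int (sign \<beta>) * x ^ num_cycles (S \<union> insert a C) (\<rho> \<circ> \<beta> \<circ> \<gamma>)) =
      (x + of_nat (card C)) * (\<Sum>\<gamma>\<in>?P C. of_int (sign \<beta>) * x ^ num_cycles ?U (\<rho> \<circ> \<beta> \<circ> \<gamma>))"
    (is "?L = _ * ?R")
    if \<beta>: "\<beta> permutes S" for \<beta>
  proof -
    have p: "\<rho> \<circ> \<beta> permutes ?U"
      using permutes_compose[OF permutes_subset[OF \<beta>] assms(4)] by auto
    have id: "num_cycles (insert a ?U) (\<rho> \<circ> \<beta> \<circ> \<gamma>) = Suc (num_cycles ?U (\<rho> \<circ> \<beta> \<circ> \<gamma>))"
      if "\<gamma> permutes C" for \<gamma>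
      using assms permutes_compose[OF permutes_subset[OF that] p]
      by (intro num_cycles_insert_fixed) auto
    have tr: "num_cycles (insert a ?U) (\<rho> \<circ> \<beta> \<circ> (transpose a b \<circ> \<gamma>)) =
        num_cycles ?U (\<rho> \<circ> \<beta> \<circ> \<gamma>)" if "\<gamma> permutes C" "b \<in> C" for \<gamma> b
      using num_cycles_comp_transpose_fixed[OF _ p permutes_subset[OF that(1)], of a b] assms that
      by (auto simp: o_assoc)
    have "?L = (\<Sum>b\<in>insert a C. \<Sum>\<gamma>\<in>?P C. of_int (sign \<beta>) *
        x ^ num_cycles (insert a ?U) (\<rho> \<circ> \<beta> \<circ> (transpose a b \<circ> \<gamma>)))"
      using assms by (subst sum_over_permutations_insert) auto
    also have "\<dots> = x * ?R + (\<Sum>b\<in>C. ?R)"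
    proof -
      have "(\<Sum>\<gamma>\<in>?P C. of_int (sign \<beta>) *
          x ^ num_cycles (insert a ?U) (\<rho> \<circ> \<beta> \<circ> (transpose a a \<circ> \<gamma>))) = x * ?R"
        unfolding sum_distrib_left by (intro sum.cong refl) (simp add: id mult.left_commute)
      moreover have "(\<Sum>\<gamma>\<in>?P C. of_int (sign \<beta>) *
          x ^ num_cycles (insert a ?U) (\<rho> \<circ> \<beta> \<circ> (transpose a b \<circ> \<gamma>))) = ?R" if "b \<in> C" for b
        using that by (intro sum.cong refl) (simp add: tr)
      ultimately show ?thesis using assms by simp
    qed
    finally show ?thesis by (simp add: algebra_simps)
  qed
  then show ?thesis
    unfolding signed_cycle_sum_def sum_distrib_left[of "x + of_nat (card C)" _ "?P S"]
    by (intro sum.cong refl) simp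
qed

text \<open>The decomposition is the same as for the right argument, but now each proper
  transposition also reverses the sign of \<open>\<beta>\<close>, so the points of \<open>S\<close>
  contribute negatively.\<close>

lemma signed_cycle_sum_insert_left:
  assumes "finite S" "finite C" "S \<inter> C = {}" "\<rho> permutes S \<union> C" "a \<notin> S \<union> C"
  shows "signed_cycle_sum x \<rho> (insert a S) C = (x - of_nat (card S)) * signed_cycle_sum x \<rho> S C"
proof -
  let ?P = "\<lambda>A. {p. p permutes A}"
  let ?U = "S \<union> C"
  let ?R = "signed_cycle_sum x \<rho> S C"
  have sub: "\<beta> \<circ> \<gamma> permutes ?U" if "\<beta> permutes S" "\<gamma> permutes C" for \<beta> \<gamma>
    using permutes_compose[OF permutes_subset[OF that(2)] permutes_subset[OF that(1)]] by auto
  have id: "num_cycles (insert a ?U) (\<rho> \<circ> \<beta> \<circ> \<gamma>) = Suc (num_cycles ?U (\<rho> \<circ> \<beta> \<circ> \<gamma>))"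
    if "\<beta> permutes S" "\<gamma> permutes C" for \<beta> \<gamma>
    using assms permutes_compose[OF sub[OF that] assms(4)]
    by (intro num_cycles_insert_fixed) (auto simp: o_assoc)
  have tr: "num_cycles (insert a ?U) (\<rho> \<circ> (transpose a b \<circ> \<beta>) \<circ> \<gamma>) =
      num_cycles ?U (\<rho> \<circ> \<beta> \<circ> \<gamma>)" if "\<beta> permutes S" "\<gamma> permutes C" "b \<in> S" for \<beta> \<gamma> b
    using num_cycles_comp_transpose_fixed[OF _ assms(4) sub[OF that(1,2)], of a b] assms that
    by (auto simp: o_assoc)
  have sg: "sign (transpose a b \<circ> \<beta>) = - sign \<beta>" if "\<beta> permutes S" "b \<in> S" for \<beta> b
    using that assms
    by (subst sign_compose)
      (auto simp: permutation_swap_id sign_swap_id intro: permutes_imp_permutation)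
  have "signed_cycle_sum x \<rho> (insert a S) C = (\<Sum>b\<in>insert a S. \<Sum>\<beta>\<in>?P S. \<Sum>\<gamma>\<in>?P C.
      of_int (sign (transpose a b \<circ> \<beta>)) *
      x ^ num_cycles (insert a ?U) (\<rho> \<circ> (transpose a b \<circ> \<beta>) \<circ> \<gamma>))"
    unfolding signed_cycle_sum_def
    using assms by (subst sum_over_permutations_insert) auto
  also have "\<dots> = x * ?R + (\<Sum>b\<in>S. - ?R)"
  proof -
    have "(\<Sum>\<beta>\<in>?P S. \<Sum>\<gamma>\<in>?P C. of_int (sign (transpose a a \<circ> \<beta>)) *
        x ^ num_cycles (insert a ?U) (\<rho> \<circ> (transpose a a \<circ> \<beta>) \<circ> \<gamma>)) = x * ?R"
      unfolding signed_cycle_sum_def sum_distrib_left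
      by (intro sum.cong refl) (simp add: id mult.left_commute)
    moreover have "(\<Sum>\<beta>\<in>?P S. \<Sum>\<gamma>\<in>?P C. of_int (sign (transpose a b \<circ> \<beta>)) *
        x ^ num_cycles (insert a ?U) (\<rho> \<circ> (transpose a b \<circ> \<beta>) \<circ> \<gamma>)) = - ?R" if "b \<in> S" for b
      unfolding signed_cycle_sum_def sum_negf[symmetric]
      using that by (intro sum.cong refl) (simp add: tr sg)
    ultimately show ?thesis using assms by simp
  qed
  finally show ?thesis by (simp add: algebra_simps)
qed

text \<open>Permutations of the disjoint sets \<open>S\<close> and \<open>C\<close> commute, so
  \<open>\<beta>\<^sub>0\<close> and \<open>\<gamma>\<^sub>0\<close> are absorbed by translating the
  two summation variables. Only the sign of \<open>\<beta>\<^sub>0\<close> is left over.\<close>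

lemma signed_cycle_sum_comp:
  fixes \<rho> :: "'a \<Rightarrow> 'a"
  assumes "finite S" "S \<inter> C = {}" "\<beta>\<^sub>0 permutes S" "\<gamma>\<^sub>0 permutes C"
  shows "signed_cycle_sum x (\<rho> \<circ> \<beta>\<^sub>0 \<circ> \<gamma>\<^sub>0) S C = of_int (sign \<beta>\<^sub>0) * signed_cycle_sum x \<rho> S C"
proof -
  let ?P = "\<lambda>A. {p. p permutes A}"
  let ?f = "\<lambda>\<beta> \<gamma>. x ^ num_cycles (S \<union> C) (\<rho> \<circ> \<beta> \<circ> \<gamma>)"
  have comm: "\<gamma>\<^sub>0 \<circ> \<beta> = \<beta> \<circ> \<gamma>\<^sub>0" if "\<beta> permutes S" for \<beta>
  proof
    fix y
    consider "y \<in> S" | "y \<in> C" | "y \<notin> S" "y \<notin> C" by blast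
    then show "(\<gamma>\<^sub>0 \<circ> \<beta>) y = (\<beta> \<circ> \<gamma>\<^sub>0) y"
    proof cases
      case 1
      then have "y \<notin> C" "\<beta> y \<notin> C" using assms(2) permutes_in_image[OF that] by blast+
      then show ?thesis using assms(4) by (simp add: permutes_not_in)
    next
      case 2
      then have "y \<notin> S" "\<gamma>\<^sub>0 y \<notin> S" using assms(2) permutes_in_image[OF assms(4)] by blast+
      then show ?thesis using that by (simp add: permutes_not_in)
    qed (use that assms(4) in \<open>simp add: permutes_not_in\<close>)
  qed
  have sg: "sign \<beta> = sign \<beta>\<^sub>0 * sign (\<beta>\<^sub>0 \<circ> \<beta>)" if "\<beta> permutes S" for \<beta>
    using that assms by (subst sign_compose) (auto simp: permutation_permutes)
  have "signed_cycle_sum x (\<rho> \<circ> \<beta>\<^sub>0 \<circ> \<gamma>\<^sub>0) S C =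
      (\<Sum>\<beta>\<in>?P S. \<Sum>\<gamma>\<in>?P C. of_int (sign \<beta>\<^sub>0) * (of_int (sign (\<beta>\<^sub>0 \<circ> \<beta>)) * ?f (\<beta>\<^sub>0 \<circ> \<beta>) (\<gamma>\<^sub>0 \<circ> \<gamma>)))"
    unfolding signed_cycle_sum_def
  proof (intro sum.cong refl)
    fix \<beta> \<gamma> assume "\<beta> \<in> ?P S" "\<gamma> \<in> ?P C"
    then have \<beta>: "\<beta> permutes S" by simp
    have "\<rho> \<circ> \<beta>\<^sub>0 \<circ> \<gamma>\<^sub>0 \<circ> \<beta> \<circ> \<gamma> = \<rho> \<circ> \<beta>\<^sub>0 \<circ> (\<gamma>\<^sub>0 \<circ> \<beta>) \<circ> \<gamma>" by (simp add: o_assoc)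
    also have "\<dots> = \<rho> \<circ> (\<beta>\<^sub>0 \<circ> \<beta>) \<circ> (\<gamma>\<^sub>0 \<circ> \<gamma>)" unfolding comm[OF \<beta>] by (simp add: o_assoc)
    finally show "of_int (sign \<beta>) * x ^ num_cycles (S \<union> C) (\<rho> \<circ> \<beta>\<^sub>0 \<circ> \<gamma>\<^sub>0 \<circ> \<beta> \<circ> \<gamma>) =
        of_int (sign \<beta>\<^sub>0) * (of_int (sign (\<beta>\<^sub>0 \<circ> \<beta>)) * ?f (\<beta>\<^sub>0 \<circ> \<beta>) (\<gamma>\<^sub>0 \<circ> \<gamma>))"
      by (simp add: sg[OF \<beta>] mult.assoc)
  qed
  also have "\<dots> = of_int (sign \<beta>\<^sub>0) *
      (\<Sum>\<beta>\<in>?P S. \<Sum>\<gamma>\<in>?P C. of_int (sign (\<beta>\<^sub>0 \<circ> \<beta>)) * ?f (\<beta>\<^sub>0 \<circ> \<beta>) (\<gamma>\<^sub>0 \<circ> \<gamma>))"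
    by (simp add: sum_distrib_left)
  also have "(\<Sum>\<beta>\<in>?P S. \<Sum>\<gamma>\<in>?P C. of_int (sign (\<beta>\<^sub>0 \<circ> \<beta>)) * ?f (\<beta>\<^sub>0 \<circ> \<beta>) (\<gamma>\<^sub>0 \<circ> \<gamma>)) =
      (\<Sum>\<beta>\<in>?P S. \<Sum>\<gamma>\<in>?P C. of_int (sign (\<beta>\<^sub>0 \<circ> \<beta>)) * ?f (\<beta>\<^sub>0 \<circ> \<beta>) \<gamma>)"
    by (intro sum.cong refl setum_permutations_compose_left[OF assms(4), symmetric])
  also have "\<dots> = signed_cycle_sum x \<rho> S C"
    unfolding signed_cycle_sum_def by (rule setum_permutations_compose_left[OF assms(3), symmetric])
  finally show ?thesis .
qed

text \<open>With \<open>t = (a b)\<close> and \<open>u = (\<rho> a  \<rho> b)\<close> we have \<open>\<rho> \<circ> t = u \<circ> \<rho>\<close>: replacing \<open>\<beta>\<close> by \<open>t \<circ> \<beta>\<close>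
  negates the sum, but conjugation by \<open>u\<close> turns this into replacing \<open>\<gamma>\<close> by \<open>\<gamma> \<circ> u\<close>, which
  does not change it.\<close>

lemma signed_cycle_sum_eq_0:
  fixes x :: "'b :: {comm_ring_1, ring_char_0, semiring_no_zero_divisors}"
  assumes "finite S" "finite C" "S \<inter> C = {}" "\<rho> permutes S \<union> C"
    and "a \<in> S" "b \<in> S" "a \<noteq> b" "\<rho> a \<notin> S" "\<rho> b \<notin> S"
  shows "signed_cycle_sum x \<rho> S C = 0"
proof -
  let ?P = "\<lambda>A. {p. p permutes A}"
  let ?U = "S \<union> C"
  define t u where "t = transpose a b" and "u = transpose (\<rho> a) (\<rho> b)"
  have t: "t permutes S" using assms by (simp add: t_def permutes_swap_id)
  have "\<rho> a \<in> C" "\<rho> b \<in> C" using assms permutes_in_image[OF assms(4)] by blast+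
  then have u: "u permutes C" by (simp add: u_def permutes_swap_id)
  have tu: "\<rho> \<circ> t = u \<circ> \<rho>"
    unfolding t_def u_def by (rule comp_transpose[OF permutes_inj[OF assms(4)]])
  have "signed_cycle_sum x (\<rho> \<circ> t \<circ> id) S C = - signed_cycle_sum x \<rho> S C"
    using signed_cycle_sum_comp[OF assms(1,3) t permutes_id] assms by (simp add: t_def sign_swap_id)
  moreover have "signed_cycle_sum x (\<rho> \<circ> t \<circ> id) S C = signed_cycle_sum x \<rho> S C"
  proof -
    have "num_cycles ?U (\<rho> \<circ> t \<circ> \<beta> \<circ> \<gamma>) = num_cycles ?U (\<rho> \<circ> \<beta> \<circ> (\<gamma> \<circ> u))"
      if "\<beta> permutes S" "\<gamma> permutes C" for \<beta> \<gamma>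
    proof -
      have "u permutes ?U" "\<beta> permutes ?U" "\<gamma> permutes ?U"
        using u that permutes_subset by blast+
      then show ?thesis unfolding tu
        using num_cycles_comp_commute[of ?U u "\<rho> \<circ> \<beta> \<circ> \<gamma>"] assms
        by (simp add: o_assoc permutes_compose)
    qed
    then have "signed_cycle_sum x (\<rho> \<circ> t \<circ> id) S C = (\<Sum>\<beta>\<in>?P S. \<Sum>\<gamma>\<in>?P C.
        of_int (sign \<beta>) * x ^ num_cycles ?U (\<rho> \<circ> \<beta> \<circ> (\<gamma> \<circ> u)))"
      unfolding signed_cycle_sum_def by (intro sum.cong refl) (simp add: o_def)
    also have "\<dots> = signed_cycle_sum x \<rho> S C"
      unfolding signed_cycle_sum_def
      by (intro sum.cong refl sum_permutations_compose_right[OF u, symmetric])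
    finally show ?thesis .
  qed
  \<comment> \<open>The sum equals its own negative; characteristic zero and the absence of zero
    divisors make it vanish.\<close>
  ultimately show ?thesis
    by (metis add_cancel_right_left add.right_inverse mult_2 mult_eq_0_iff zero_neq_numeral)
qed

section \<open>Evaluation at the identity, at a transposition and on arcs\<close>

lemma signed_cycle_sum_id:
  assumes "finite C"
  shows "signed_cycle_sum x id {} C = pochhammer x (card C)"
  using assms
proof (induction C rule: finite_induct)
  case empty
  show ?case by (simp add: signed_cycle_sum_def num_cycles_def)
next
  case (insert a C)
  have "signed_cycle_sum x id {} (insert a C) = (x + of_nat (card C)) * signed_cycle_sum x id {} C"
    by (rule signed_cycle_sum_insert_right) (use insert.hyps permutes_id in auto)
  then show ?case
    by (simp only: insert.IH card_insert_disjoint[OF insert.hyps] pochhammer_rec')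
qed

text \<open>The sets \<open>{a}\<close> and \<open>{p}\<close> give a single cycle and the value
  \<open>x\<close>. All further points are fixed by the transposition, so adding \<open>C\<close> on
  the right yields the factors \<open>x + 1\<close>, \<open>x + 2\<close>, ..., and adding
  \<open>S\<close> on the left yields \<open>x - 1\<close>, \<open>x - 2\<close>, .... Both start at
  distance 1 because \<open>p\<close> and \<open>a\<close> are already present.\<close>

lemma signed_cycle_sum_transpose:
  assumes "finite S" "finite C" "S \<inter> C = {}" "a \<noteq> p" "a \<notin> S" "p \<notin> S" "a \<notin> C" "p \<notin> C"
  shows "signed_cycle_sum x (transpose a p) (insert a S) (insert p C) =
    pochhammer (x - of_nat (card S)) (Suc (card S + card C))"
proof -
  have tau: "transpose a p permutes insert a S' \<union> insert p C'" for S' C'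
    by (rule permutes_swap_id) auto
  have right: "signed_cycle_sum x (transpose a p) {a} (insert p C) = pochhammer x (Suc (card C))"
    using \<open>finite C\<close> \<open>a \<notin> C\<close> \<open>p \<notin> C\<close>
  proof (induction C rule: finite_induct)
    case empty
    have "num_cycles {a, p} (transpose a p) = num_cycles {p} id"
      using num_cycles_insert_transpose[of "{p}" id a p] \<open>a \<noteq> p\<close> by (simp add: permutes_id)
    then show ?case by (simp add: signed_cycle_sum_def num_cycles_def insert_commute)
  next
    case (insert c C)
    have "signed_cycle_sum x (transpose a p) {a} (insert c (insert p C)) =
        (x + of_nat (card (insert p C))) * signed_cycle_sum x (transpose a p) {a} (insert p C)"
      by (rule signed_cycle_sum_insert_right)
        (use insert.hyps insert.prems tau[of "{}" C] \<open>a \<noteq> p\<close> in auto)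
    also have "\<dots> = pochhammer x (Suc (card (insert c C)))"
      using insert by (simp add: pochhammer_rec'[of x "Suc (card C)"])
    finally show ?case by (simp only: insert_commute)
  qed
  show ?thesis
    using \<open>finite S\<close> \<open>S \<inter> C = {}\<close> \<open>a \<notin> S\<close> \<open>p \<notin> S\<close>
  proof (induction S rule: finite_induct)
    case empty
    then show ?case using right by simp
  next
    case (insert c S)
    have "signed_cycle_sum x (transpose a p) (insert a (insert c S)) (insert p C) =
        (x - of_nat (Suc (card S))) * pochhammer (x - of_nat (card S)) (Suc (card S + card C))"
    proof -
      have "signed_cycle_sum x (transpose a p) (insert c (insert a S)) (insert p C) =
          (x - of_nat (card (insert a S))) *
            signed_cycle_sum x (transpose a p) (insert a S) (insert p C)"
        by (rule signed_cycle_sum_insert_left[OF _ _ _ tau]) (use insert.hyps insert.prems assms in auto)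
      then show ?thesis using insert by (simp add: insert_commute)
    qed
    also have "\<dots> = pochhammer (x - of_nat (Suc (card S))) (Suc (Suc (card S + card C)))"
      by (subst pochhammer_rec[of "x - of_nat (Suc (card S))"]) simp
    finally show ?case using insert by simp
  qed
qed

text \<open>The cycle runs backwards through the listed points, so that it will undo a permutation
  stepping forwards along them. It is a product of \<open>s\<close> transpositions, which gives its
  sign.\<close>

lemma exists_backward_cycle:
  assumes "inj_on a {..s}"
  obtains \<beta> where "\<beta> permutes a ` {..s}" "sign \<beta> = (-1) ^ s" "\<beta> (a 0) = a s"
    "\<And>i. i < s \<Longrightarrow> \<beta> (a (Suc i)) = a i"
proof -
  have "\<exists>\<beta>. \<beta> permutes a ` {..s} \<and> sign \<beta> = (-1) ^ s \<and> \<beta> (a 0) = a s \<and>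
      (\<forall>i<s. \<beta> (a (Suc i)) = a i)"
    using assms
  proof (induction s)
    case 0
    show ?case by (intro exI[of _ id]) (auto simp: fun_eq_iff)
  next
    case (Suc s)
    then obtain \<beta> where \<beta>: "\<beta> permutes a ` {..s}" "sign \<beta> = (-1) ^ s" "\<beta> (a 0) = a s"
      "\<And>i. i < s \<Longrightarrow> \<beta> (a (Suc i)) = a i"
      using inj_on_subset[of a "{..Suc s}" "{..s}"] by auto
    have new: "a (Suc s) \<notin> a ` {..s}"
      using Suc.prems inj_on_image_mem_iff[of a "{..Suc s}" "Suc s" "{..s}"] by auto
    have ne: "a i \<noteq> a j" if "i < j" "j \<le> Suc s" for i j
      using that Suc.prems by (auto simp: inj_on_def)
    let ?\<beta> = "\<beta> \<circ> transpose (a 0) (a (Suc s))"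
    have "?\<beta> permutes a ` {..Suc s}"
      by (intro permutes_compose permutes_swap_id permutes_subset[OF \<beta>(1)]) auto
    moreover have "sign ?\<beta> = (-1) ^ Suc s"
    proof -
      have "permutation \<beta>" using \<beta>(1) by (auto intro: permutes_imp_permutation)
      then have "sign ?\<beta> = sign \<beta> * sign (transpose (a 0) (a (Suc s)))"
        by (rule sign_compose) (rule permutation_swap_id)
      then show ?thesis using ne[of 0 "Suc s"] \<beta>(2) by (simp add: sign_swap_id)
    qed
    moreover have "?\<beta> (a 0) = a (Suc s)"
      using permutes_not_in[OF \<beta>(1) new] by simp
    moreover have "?\<beta> (a (Suc i)) = a i" if "i < Suc s" for i
    proof (cases "i = s")
      case True
      then show ?thesis using \<beta>(3) by simp
    next
      case False
      then have "a (Suc i) \<noteq> a 0" "a (Suc i) \<noteq> a (Suc s)"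
        using ne[of 0 "Suc i"] ne[of "Suc i" "Suc s"] that by auto
      then show ?thesis using \<beta>(4)[of i] False that by (simp add: transpose_def)
    qed
    ultimately show ?case by blast
  qed
  then show ?thesis using that by blast
qed

text \<open>Multiplying \<open>\<pi>\<close> by a cycle on the arc and by a permutation of its complement leaves only the
  transposition of the first point of the arc and the point following the arc.\<close>

lemma signed_cycle_sum_arc:
  assumes "finite U" "\<pi> permutes U" "inj_on a {..Suc s}" "a ` {..Suc s} \<subseteq> U"
    and step: "\<And>i. i \<le> s \<Longrightarrow> \<pi> (a i) = a (Suc i)"
  shows "signed_cycle_sum x \<pi> (a ` {..s}) (U - a ` {..s}) =
    (-1) ^ s * pochhammer (x - of_nat s) (card U - 1)"
proof -
  define S where "S = a ` {..s}"
  obtain \<beta> where \<beta>: "\<beta> permutes S" "sign \<beta> = (-1) ^ s" "\<beta> (a 0) = a s"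
    "\<And>i. i < s \<Longrightarrow> \<beta> (a (Suc i)) = a i"
    using exists_backward_cycle[of a s] inj_on_subset[OF assms(3), of "{..s}"]
    unfolding S_def by auto
  have SU: "S \<subseteq> U" using assms(4) by (auto simp: S_def)
  define \<tau> where "\<tau> = transpose (a 0) (a (Suc s))"
  \<comment> \<open>This \<open>\<gamma>\<close> solves
    \<open>\<pi> \<circ> \<beta> \<circ> \<gamma> = \<tau>\<close>. It fixes \<open>S\<close>
    pointwise because \<open>\<pi> \<circ> \<beta>\<close> agrees with \<open>\<tau>\<close>
    there.\<close>
  define \<gamma> where "\<gamma> = inv (\<pi> \<circ> \<beta>) \<circ> \<tau>"
  have pb: "\<pi> \<circ> \<beta> permutes U"
    using permutes_compose[OF permutes_subset[OF \<beta>(1) SU] assms(2)] .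
  have ne: "a i \<noteq> a j" if "i < j" "j \<le> Suc s" for i j
    using that assms(3) by (auto simp: inj_on_def)
  have "\<tau> y = (\<pi> \<circ> \<beta>) y" if y: "y \<in> S" for y
  proof -
    obtain i where i: "y = a i" "i \<le> s" using y by (auto simp: S_def)
    show ?thesis
    proof (cases i)
      case 0
      then show ?thesis using i \<beta>(3) step[of s] by (simp add: \<tau>_def)
    next
      case (Suc j)
      then have "a i \<noteq> a 0" "a i \<noteq> a (Suc s)" using ne[of 0 i] ne[of i "Suc s"] i by auto
      then show ?thesis using i Suc \<beta>(4)[of j] step[of j] by (simp add: \<tau>_def)
    qed
  qed
  then have fixS: "\<gamma> y = y" if "y \<in> S" for y
    using that permutes_inverses(2)[OF pb, of y] by (simp add: \<gamma>_def)
  have \<tau>: "\<tau> permutes U"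
    unfolding \<tau>_def using assms(4) by (intro permutes_swap_id) auto
  have "\<gamma> permutes U"
    unfolding \<gamma>_def by (intro permutes_compose \<tau> permutes_inv pb)
  then have \<gamma>: "\<gamma> permutes U - S"
    by (rule permutes_superset) (use fixS in auto)
  have "\<pi> \<circ> \<beta> \<circ> \<gamma> = \<tau>"
    using permutes_inv_o(1)[OF pb] by (simp add: \<gamma>_def o_assoc)
  then have "signed_cycle_sum x \<tau> S (U - S) = of_int (sign \<beta>) * signed_cycle_sum x \<pi> S (U - S)"
    using signed_cycle_sum_comp[OF _ _ \<beta>(1) \<gamma>, of x \<pi>] by (simp add: S_def)
  \<comment> \<open>The sign squares to 1, so it may be moved to the other side.\<close>
  then have "signed_cycle_sum x \<pi> S (U - S) = (-1) ^ s * signed_cycle_sum x \<tau> S (U - S)"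
    by (simp add: \<beta>(2) flip: mult.assoc power_add)
  moreover have "signed_cycle_sum x \<tau> S (U - S) = pochhammer (x - of_nat s) (card U - 1)"
  proof -
    \<comment> \<open>The arc and its complement, each without its point moved by
      \<open>\<tau>\<close>.\<close>
    define S' C' where "S' = a ` {Suc 0..s}" and "C' = U - a ` {..Suc s}"
    have S: "S = insert (a 0) S'"
      by (auto simp: S_def S'_def image_iff) (metis Suc_leI atLeastAtMost_iff atMost_iff gr0I)
    have C: "U - S = insert (a (Suc s)) C'"
      using assms(4) ne[of _ "Suc s"] by (auto simp: S_def C'_def atMost_Suc) (metis le_imp_less_Suc)
    have cS: "card S' = s"
      unfolding S'_def using inj_on_subset[OF assms(3), of "{Suc 0..s}"] by (subst card_image) auto
    have "card (a ` {..Suc s}) = Suc (Suc s)" using assms(3) by (subst card_image) auto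
    \<comment> \<open>The lower bound on \<open>card U\<close> makes the truncated subtractions
      exact.\<close>
    then have cC: "card C' = card U - Suc (Suc s)" "card U \<ge> Suc (Suc s)"
      using assms(1,4) card_mono[OF assms(1,4)] by (auto simp: C'_def card_Diff_subset)
    have "signed_cycle_sum x \<tau> S (U - S) =
        pochhammer (x - of_nat (card S')) (Suc (card S' + card C'))"
      unfolding \<tau>_def C unfolding S
    proof (rule signed_cycle_sum_transpose)
      show "a 0 \<noteq> a (Suc s)" by (rule ne) auto
      show "a 0 \<notin> S'" "a (Suc s) \<notin> S'"
        using inj_on_image_mem_iff[OF assms(3), of _ "{Suc 0..s}"] by (auto simp: S'_def)
    qed (use assms(1) in \<open>auto simp: S'_def C'_def\<close>)
    moreover have "Suc (card S' + card C') = card U - 1" using cS cC by simp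
    ultimately show ?thesis using cS by simp
  qed
  ultimately show ?thesis by (simp add: S_def)
qed

section \<open>Inclusion-exclusion over invariant sets\<close>

text \<open>Invariant sets avoiding \<open>r\<close> are exactly the unions of orbits other than
  that of \<open>r\<close>. The sum is therefore \<open>(1 - 1) ^ card K\<close>, where
  \<open>K\<close> is the set of these orbits, and it is nonzero only if the orbit of
  \<open>r\<close> is everything.\<close>

lemma sum_invariant_subsets:
  assumes "finite U" "\<zeta> permutes U" "r \<in> U"
  shows "(\<Sum>S | S \<subseteq> U - {r} \<and> \<zeta> ` S = S. (-1) ^ num_cycles S \<zeta>) =
    (if cyclic_on \<zeta> U then 1 else 0 :: 'b :: comm_ring_1)"
proof -
  let ?o = "orbit \<zeta>"
  define K where "K = ?o ` U - {?o r}"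
  have perm: "permutation \<zeta>" using assms by (auto simp: permutation_permutes)
  note self = permutation_self_in_orbit[OF perm]
  have eq: "?o z = ?o y" if "z \<in> ?o y" for y z
    using orbit_cyclic_eq3[OF cyclic_on_orbit'[OF perm] that] .
  have sub: "?o y \<subseteq> S" if "\<zeta> ` S = S" "y \<in> S" for y S
  proof
    fix z assume "z \<in> ?o y"
    then show "z \<in> S" by induction (use that in auto)
  qed
  have Un: "\<Union>(?o ` S) = S" if "\<zeta> ` S = S" for S
    using sub[OF that] self by auto
  have im: "?o ` \<Union>X = X" if "X \<subseteq> K" for X
  proof (intro equalityI subsetI)
    fix A assume "A \<in> ?o ` \<Union>X"
    then obtain y B where "A = ?o y" "y \<in> B" "B \<in> X" by blast
    then show "A \<in> X" using that eq by (auto simp: K_def)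
  next
    fix A assume "A \<in> X"
    moreover obtain y where "A = ?o y" using \<open>A \<in> X\<close> \<open>X \<subseteq> K\<close> by (auto simp: K_def)
    ultimately show "A \<in> ?o ` \<Union>X" using self[of y] by blast
  qed
  have inv: "\<zeta> ` \<Union>X = \<Union>X" if "X \<subseteq> K" for X
  proof -
    have "\<zeta> ` ?o y = ?o y" for y
      using orbit_inverse[OF self[of y], of \<zeta> \<zeta>] permutation_orbit_step[OF perm] by auto
    then have "\<zeta> ` A = A" if "A \<in> X" for A
    proof -
      obtain y where "A = ?o y" using \<open>A \<in> X\<close> \<open>X \<subseteq> K\<close> by (auto simp: K_def)
      then show ?thesis using \<open>\<And>y. \<zeta> ` ?o y = ?o y\<close> by simp
    qed
    then show ?thesis by (auto simp: image_Union)
  qed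
  have "(\<Sum>S | S \<subseteq> U - {r} \<and> \<zeta> ` S = S. (-1) ^ num_cycles S \<zeta>) = (\<Sum>X\<in>Pow K. (-1 :: 'b) ^ card X)"
  proof (rule sum.reindex_bij_witness[where i = "\<lambda>X. \<Union>X" and j = "\<lambda>S. ?o ` S"])
    fix S assume S: "S \<in> {S. S \<subseteq> U - {r} \<and> \<zeta> ` S = S}"
    show "\<Union>(?o ` S) = S" using S Un by simp
    \<comment> \<open>An invariant set meeting the orbit of \<open>r\<close> would contain
      \<open>r\<close>.\<close>
    have "?o y \<noteq> ?o r" if "y \<in> S" for y
      using sub[of S y] self[of r] S that by auto
    then show "?o ` S \<in> Pow K" using S by (auto simp: K_def)
    show "(-1 :: 'b) ^ card (?o ` S) = (-1) ^ num_cycles S \<zeta>" by (simp add: num_cycles_def)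
  next
    fix X assume "X \<in> Pow K"
    then have X: "X \<subseteq> K" by simp
    show "?o ` \<Union>X = X" using im[OF X] .
    have "\<Union>X \<subseteq> U" using X permutes_orbit_subset[OF assms(2)] by (auto simp: K_def)
    moreover have "r \<notin> \<Union>X" using X eq[of r] by (auto simp: K_def)
    ultimately show "\<Union>X \<in> {S. S \<subseteq> U - {r} \<and> \<zeta> ` S = S}" using inv[OF X] by auto
  qed
  also have "\<dots> = (\<Prod>A\<in>K. 1 - 1)"
    using assms(1) by (subst prod_diff_conv_sum) (auto simp: K_def)
  also have "\<dots> = (if K = {} then 1 else 0)"
  proof -
    have "finite K" using assms(1) by (simp add: K_def)
    then show ?thesis by (simp add: power_0_left)
  qed
  also have "K = {} \<longleftrightarrow> cyclic_on \<zeta> U"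
  proof
    assume "K = {}"
    then have "y \<in> ?o r" if "y \<in> U" for y using that self[of y] by (auto simp: K_def)
    then have "U = ?o r" using permutes_orbit_subset[OF assms(2,3)] by blast
    then show "cyclic_on \<zeta> U" using assms(3) by (auto simp: cyclic_on_def)
  next
    assume "cyclic_on \<zeta> U"
    then show "K = {}" using assms(3) by (auto simp: K_def orbit_cyclic_eq3)
  qed
  finally show ?thesis .
qed

text \<open>Restricting \<open>\<zeta>\<close> to \<open>S\<close> and to \<open>C\<close> inverts
  the composition of a pair \<open>(\<beta>, \<gamma>)\<close>; injectivity of
  \<open>\<zeta>\<close> makes \<open>C\<close> invariant along with \<open>S\<close>.\<close>

lemma sum_permutes_invariant:
  assumes "finite S" "finite C" "S \<inter> C = {}"
  shows "(\<Sum>\<zeta> | \<zeta> permutes S \<union> C \<and> \<zeta> ` S = S. h \<zeta>) =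
    (\<Sum>\<beta> | \<beta> permutes S. \<Sum>\<gamma> | \<gamma> permutes C. h (\<beta> \<circ> \<gamma>))"
proof -
  let ?P = "\<lambda>A. {p. p permutes A}"
  have onS: "(\<beta> \<circ> \<gamma>) y = \<beta> y" if "\<gamma> permutes C" "y \<in> S" for \<beta> \<gamma> y
  proof -
    have "y \<notin> C" using that(2) assms(3) by blast
    then show ?thesis using permutes_not_in[OF that(1), of y] by simp
  qed
  have onC: "(\<beta> \<circ> \<gamma>) y = \<gamma> y" if "\<beta> permutes S" "\<gamma> permutes C" "y \<in> C" for \<beta> \<gamma> y
    using that assms(3) permutes_not_in[OF that(1), of "\<gamma> y"] permutes_in_image[OF that(2), of y] by auto
  have "(\<Sum>\<zeta> | \<zeta> permutes S \<union> C \<and> \<zeta> ` S = S. h \<zeta>) = (\<Sum>(\<beta>, \<gamma>)\<in>?P S \<times> ?P C. h (\<beta> \<circ> \<gamma>))"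
  proof (rule sum.reindex_bij_witness[where i = "\<lambda>(\<beta>, \<gamma>). \<beta> \<circ> \<gamma>"
        and j = "\<lambda>\<zeta>. (perm_restrict \<zeta> S, perm_restrict \<zeta> C)"])
    fix \<zeta> assume \<zeta>: "\<zeta> \<in> {\<zeta>. \<zeta> permutes S \<union> C \<and> \<zeta> ` S = S}"
    have "\<zeta> ` (S \<union> C) = S \<union> C" using \<zeta> permutes_image by blast
    then have "\<zeta> ` C = C"
      using \<zeta> assms(3) image_set_diff[of \<zeta> "S \<union> C" S] permutes_inj[of \<zeta> "S \<union> C"]
      by (auto simp: Un_Diff Diff_triv Int_commute)
    then have inv: "\<zeta> ` S = S" "\<zeta> ` C = C" using \<zeta> by auto
    have "perm_restrict \<zeta> A permutes A" if "\<zeta> ` A = A" for A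
      using \<zeta> that permutes_inj[of \<zeta> "S \<union> C"]
      by (intro bij_imp_permutes)
        (auto simp: bij_betw_def inj_on_def perm_restrict_def dest: injD cong: image_cong)
    then have pr: "perm_restrict \<zeta> S permutes S" "perm_restrict \<zeta> C permutes C" using inv by auto
    then show "(perm_restrict \<zeta> S, perm_restrict \<zeta> C) \<in> ?P S \<times> ?P C" by simp
    have eq: "perm_restrict \<zeta> S \<circ> perm_restrict \<zeta> C = \<zeta>"
      using perm_restrict_union[OF pr assms(3)] \<zeta> by simp
    show "(case (perm_restrict \<zeta> S, perm_restrict \<zeta> C) of (\<beta>, \<gamma>) \<Rightarrow> \<beta> \<circ> \<gamma>) = \<zeta>"
      using eq by simp
    show "(case (perm_restrict \<zeta> S, perm_restrict \<zeta> C) of (\<beta>, \<gamma>) \<Rightarrow> h (\<beta> \<circ> \<gamma>)) = h \<zeta>"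
      using eq by simp
  next
    fix p assume "p \<in> ?P S \<times> ?P C"
    then obtain \<beta> \<gamma> where p: "p = (\<beta>, \<gamma>)" "\<beta> permutes S" "\<gamma> permutes C" by auto
    have "\<beta> \<circ> \<gamma> permutes S \<union> C"
      using permutes_compose[OF permutes_subset[OF p(3)] permutes_subset[OF p(2)]] by auto
    moreover have "(\<beta> \<circ> \<gamma>) ` S = S"
      using image_cong[of S S "\<beta> \<circ> \<gamma>" \<beta>] onS[OF p(3), of _ \<beta>] permutes_image[OF p(2)] by simp
    ultimately show "(case p of (\<beta>, \<gamma>) \<Rightarrow> \<beta> \<circ> \<gamma>) \<in> {\<zeta>. \<zeta> permutes S \<union> C \<and> \<zeta> ` S = S}"
      using p by simp
    have "perm_restrict (\<beta> \<circ> \<gamma>) S = \<beta>"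
      using onS[OF p(3)] permutes_not_in[OF p(2)] by (auto simp: perm_restrict_def fun_eq_iff)
    moreover have "perm_restrict (\<beta> \<circ> \<gamma>) C = \<gamma>"
      using onC[OF p(2,3)] permutes_not_in[OF p(3)] by (auto simp: perm_restrict_def fun_eq_iff)
    ultimately show "(perm_restrict (case p of (\<beta>, \<gamma>) \<Rightarrow> \<beta> \<circ> \<gamma>) S,
        perm_restrict (case p of (\<beta>, \<gamma>) \<Rightarrow> \<beta> \<circ> \<gamma>) C) = p"
      using p by simp
  qed
  then show ?thesis by (simp add: sum.cartesian_product)
qed

text \<open>The cyclicity indicator is expanded over invariant sets, the sums are exchanged, and for
  fixed \<open>S\<close> each \<open>\<zeta>\<close> splits into a pair
  \<open>(\<beta>, \<gamma>)\<close>.\<close>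

lemma sum_cyclic_eq_signed_cycle_sums:
  fixes x :: "'b :: comm_ring_1"
  assumes "finite U" "r \<in> U"
  shows "(\<Sum>\<zeta> | \<zeta> permutes U \<and> cyclic_on \<zeta> U. x ^ num_cycles U (\<pi> \<circ> \<zeta>)) =
    (\<Sum>S\<in>Pow (U - {r}). (-1) ^ card S * signed_cycle_sum x \<pi> S (U - S))"
proof -
  let ?P = "{p. p permutes U}"
  let ?f = "\<lambda>\<zeta>. x ^ num_cycles U (\<pi> \<circ> \<zeta>)"
  have finP: "finite ?P" using finite_permutations[OF assms(1)] .
  have "(\<Sum>\<zeta> | \<zeta> permutes U \<and> cyclic_on \<zeta> U. ?f \<zeta>) =
      (\<Sum>\<zeta>\<in>?P. (if cyclic_on \<zeta> U then 1 else 0) * ?f \<zeta>)"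
    using finP by (intro sum.mono_neutral_cong_left) auto
  also have "\<dots> = (\<Sum>\<zeta>\<in>?P. \<Sum>S | S \<in> Pow (U - {r}) \<and> \<zeta> ` S = S. (-1) ^ num_cycles S \<zeta> * ?f \<zeta>)"
    using sum_invariant_subsets[OF assms(1) _ assms(2), where 'b = 'b]
    by (intro sum.cong refl) (simp flip: sum_distrib_right)
  also have "\<dots> = (\<Sum>S\<in>Pow (U - {r}). \<Sum>\<zeta> | \<zeta> \<in> ?P \<and> \<zeta> ` S = S. (-1) ^ num_cycles S \<zeta> * ?f \<zeta>)"
    using finP assms(1) by (intro sum.swap_restrict) auto
  also have "\<dots> = (\<Sum>S\<in>Pow (U - {r}). (-1) ^ card S * signed_cycle_sum x \<pi> S (U - S))"
  proof (intro sum.cong refl)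
    fix S assume "S \<in> Pow (U - {r})"
    then have S: "S \<union> (U - S) = U" "finite S" "finite (U - S)" "S \<inter> (U - S) = {}"
      using assms(1) finite_subset[of S U] by auto
    \<comment> \<open>As \<open>\<gamma>\<close> fixes \<open>S\<close> pointwise, the cycles inside
      \<open>S\<close> are those of \<open>\<beta>\<close>, and their parity is given by the sign of
      \<open>\<beta>\<close>.\<close>
    have w: "(-1 :: 'b) ^ num_cycles S (\<beta> \<circ> \<gamma>) = (-1) ^ card S * of_int (sign \<beta>)"
      if "\<beta> permutes S" "\<gamma> permutes U - S" for \<beta> \<gamma>
    proof -
      have "orbit \<beta> y = orbit (\<beta> \<circ> \<gamma>) y" if "y \<in> S" for y
        by (rule orbit_cong0[OF that])
          (use \<open>\<beta> permutes S\<close> \<open>\<gamma> permutes U - S\<close> in \<open>auto simp: permutes_in_image permutes_not_in\<close>)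
      then have "num_cycles S (\<beta> \<circ> \<gamma>) = num_cycles S \<beta>"
        by (simp add: num_cycles_def cong: image_cong)
      then show ?thesis
        using sign_eq_num_cycles[OF S(2) that(1)] by (simp add: power_add flip: mult.assoc power_mult_distrib)
    qed
    have "(\<Sum>\<zeta> | \<zeta> \<in> ?P \<and> \<zeta> ` S = S. (-1) ^ num_cycles S \<zeta> * ?f \<zeta>) =
        (\<Sum>\<beta> | \<beta> permutes S. \<Sum>\<gamma> | \<gamma> permutes U - S.
          (-1) ^ num_cycles S (\<beta> \<circ> \<gamma>) * ?f (\<beta> \<circ> \<gamma>))"
      using sum_permutes_invariant[OF S(2-4), of "\<lambda>\<zeta>. (-1) ^ num_cycles S \<zeta> * ?f \<zeta>"] S(1) by simp
    also have "\<dots> = (-1) ^ card S * signed_cycle_sum x \<pi> S (U - S)"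
      unfolding signed_cycle_sum_def sum_distrib_left S(1)
      by (intro sum.cong refl) (simp add: w o_assoc mult.assoc)
    finally show "(\<Sum>\<zeta> | \<zeta> \<in> ?P \<and> \<zeta> ` S = S. (-1) ^ num_cycles S \<zeta> * ?f \<zeta>) =
        (-1) ^ card S * signed_cycle_sum x \<pi> S (U - S)" .
  qed
  finally show ?thesis .
qed

section \<open>The generating function over full cycles\<close>

text \<open>Only sets with at most one point exiting under \<open>\<pi>\<close> can contribute.
  Among the sets avoiding \<open>r\<close> these are the empty set and, for each length
  \<open>s\<close>, the \<open>n - s\<close> arcs not passing through \<open>r\<close>.\<close>

lemma sum_cyclic_power_num_cycles:
  fixes x :: "'b :: {comm_ring_1, ring_char_0, semiring_no_zero_divisors}"
  assumes "finite U" "\<pi> permutes U" "cyclic_on \<pi> U"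
  defines "n \<equiv> card U"
  shows "(\<Sum>\<zeta> | \<zeta> permutes U \<and> cyclic_on \<zeta> U. x ^ num_cycles U (\<pi> \<circ> \<zeta>)) =
    pochhammer x n - (\<Sum>s\<in>{1..<n}. of_nat (n - s) * pochhammer (x - of_nat (s - 1)) (n - 1))"
proof -
  obtain r where r: "r \<in> U" using assms(3) by (auto simp: cyclic_on_def)
  \<comment> \<open>The points of \<open>U\<close> are numbered along the cycle \<open>\<pi>\<close>
    starting from \<open>r\<close>, so that \<open>u n\<close> returns to \<open>r\<close>.\<close>
  define u where "u i = (\<pi> ^^ i) r" for i
  have orb: "U = orbit \<pi> r" using orbit_cyclic_eq3[OF assms(3) r] by simp
  then have self: "r \<in> orbit \<pi> r" using r by simp
  have "n = funpow_dist1 \<pi> r r"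
    unfolding n_def using orb orbit_conv_funpow_dist1[OF self] inj_on_funpow_dist1[OF self]
    by (simp add: card_image)
  then have inj: "inj_on u {..<n}" and U: "U = u ` {..<n}" and un: "u n = r" and n: "n \<ge> 1"
    using orb orbit_conv_funpow_dist1[OF self] inj_on_funpow_dist1[OF self]
      funpow_dist1_prop[OF self]
    by (auto simp: u_def[abs_def] atLeast0LessThan)
  have u0: "u 0 = r" and step: "\<pi> (u i) = u (Suc i)" for i by (simp_all add: u_def)
  have u_eq: "u i = u j \<longleftrightarrow> i = j" if "i < n" "j < n" for i j
    using inj that by (auto simp: inj_on_def)
  define W where "W S = (-1) ^ card S * signed_cycle_sum x \<pi> S (U - S)" for S
  \<comment> \<open>A pair \<open>(s, i)\<close> stands for the arc of length \<open>s\<close>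
    starting at \<open>u i\<close>. Since \<open>i\<close> is at least 1 and \<open>i + s\<close> at
    most \<open>n\<close>, the arc misses \<open>r = u 0\<close>.\<close>
  define I where "I = Sigma {1..<n} (\<lambda>s. {1..n - s})"
  define arc where "arc = (\<lambda>(s, i). u ` {i..<i + s})"
  have finI: "finite I" by (simp add: I_def)

  have arc_sub: "arc p \<in> Pow (U - {r}) - {{}}" if "p \<in> I" for p
    using that n by (auto simp: arc_def I_def U u_eq simp flip: u0)
  have "inj_on arc I"
  proof (rule inj_onI, clarify)
    fix s i s' i' assume I: "(s, i) \<in> I" "(s', i') \<in> I" and "arc (s, i) = arc (s', i')"
    then have "u ` {i..<i + s} = u ` {i'..<i' + s'}" by (simp add: arc_def)
    moreover have "{i..<i + s} \<subseteq> {..<n}" "{i'..<i' + s'} \<subseteq> {..<n}" using I by (auto simp: I_def)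
    ultimately have "{i..<i + s} = {i'..<i' + s'}" by (simp add: inj_on_image_eq_iff[OF inj])
    then show "s = s' \<and> i = i'" using I by (auto simp: I_def Ico_eq_Ico)
  qed

  \<comment> \<open>An arc of length \<open>s\<close> is listed by the indices up to
    \<open>s - 1\<close>, so the signs \<open>(-1) ^ s\<close> and \<open>(-1) ^ (s - 1)\<close>
    multiply to -1.\<close>
  have W_arc: "W (arc (s, i)) = - pochhammer (x - of_nat (s - 1)) (n - 1)" if "(s, i) \<in> I" for s i
  proof -
    obtain t where t: "s = Suc t" using \<open>(s, i) \<in> I\<close> by (cases s) (auto simp: I_def)
    have lim: "1 \<le> i" "i + Suc t \<le> n" using \<open>(s, i) \<in> I\<close> t by (auto simp: I_def)
    define a where "a j = u (i + j)" for j
    have a_arc: "arc (s, i) = a ` {..t}"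
    proof -
      have "{i..<i + s} = (+) i ` {..t}"
        using image_add_atLeastLessThan[of i 0 "Suc t"] t
        by (simp add: atLeast0LessThan lessThan_Suc_atMost add.commute)
      then show ?thesis by (simp add: arc_def a_def image_image)
    qed
    \<comment> \<open>The point after the arc may be \<open>u n = r\<close>. Rewriting it as
      \<open>u 0\<close> shows that it is still distinct from the arc, whose indices start at 1 or
      later.\<close>
    have "a j = (if i + j = n then u 0 else u (i + j))" for j using un u0 by (simp add: a_def)
    then have "inj_on a {..Suc t}"
      using lim u_eq by (intro inj_onI) (auto simp: u_eq split: if_splits)
    moreover have "a ` {..Suc t} \<subseteq> U"
      unfolding a_def u_def using cyclic_on_funpow_in[OF assms(3) r] by auto
    ultimately have "signed_cycle_sum x \<pi> (a ` {..t}) (U - a ` {..t}) =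
        (-1) ^ t * pochhammer (x - of_nat t) (n - 1)"
      unfolding n_def by (rule signed_cycle_sum_arc[OF assms(1,2)]) (simp add: a_def step)
    moreover have "card (a ` {..t}) = Suc t"
      using inj_on_subset[OF \<open>inj_on a {..Suc t}\<close>, of "{..t}"] by (subst card_image) auto
    ultimately show ?thesis
      unfolding W_def a_arc using t by (simp flip: mult.assoc power_mult_distrib)
  qed

  have W_zero: "W S = 0" if S: "S \<in> Pow (U - {r})" "S \<notin> insert {} (arc ` I)" for S
  proof -
    define J where "J = {j \<in> {1..<n}. u j \<in> S}"
    have SJ: "S = u ` J"
    proof (intro equalityI subsetI)
      fix y assume y: "y \<in> S"
      then obtain j where "y = u j" "j < n" using S(1) U by auto
      moreover have "j \<noteq> 0" using y S(1) u0 \<open>y = u j\<close> by (cases j) auto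
      ultimately show "y \<in> u ` J" using y by (auto simp: J_def)
    qed (auto simp: J_def)
    have J: "finite J" "J \<noteq> {}"
    proof -
      show "finite J" by (simp add: J_def)
      show "J \<noteq> {}" using S(2) SJ by blast
    qed
    define i m where "i = Min J" and "m = Max J"
    have iJ: "i \<in> J" and mJ: "m \<in> J" using J by (simp_all add: i_def m_def)
    \<comment> \<open>The successor of the last position either wraps around to \<open>r\<close> or
      lies beyond the maximum of \<open>J\<close>.\<close>
    have m_exit: "u (Suc m) \<notin> S"
    proof (cases "Suc m = n")
      case True
      then show ?thesis using un S(1) by auto
    next
      case False
      then have "Suc m \<in> {1..<n}" using mJ by (auto simp: J_def)
      moreover have "Suc m \<notin> J" using Max_ge[OF J(1), of "Suc m"] by (auto simp: m_def)
      ultimately show ?thesis by (auto simp: J_def)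
    qed
    \<comment> \<open>A second exit must exist: otherwise all positions from the minimum to the
      maximum of \<open>J\<close> would belong to \<open>J\<close>, and \<open>S\<close> would be an
      arc.\<close>
    have "\<exists>k. k \<in> J \<and> k < m \<and> u (Suc k) \<notin> S"
    proof (rule ccontr)
      assume none: "\<not> ?thesis"
      have "k \<in> J" if "i \<le> k" "k \<le> m" for k
        using that
      proof (induction k rule: dec_induct)
        case base
        show ?case by (rule iJ)
      next
        case (step k)
        then have "u (Suc k) \<in> S" using none by auto
        then show ?case using step mJ by (auto simp: J_def)
      qed
      then have "{i..m} \<subseteq> J" by auto
      moreover have "J \<subseteq> {i..m}" using J(1) by (auto simp: i_def m_def)
      ultimately have "J = {i..m}" by blast
      moreover have "i \<le> m" using J mJ by (simp add: i_def)
      ultimately have "S = arc (Suc m - i, i)"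
        using SJ by (simp add: arc_def atLeastLessThanSuc_atLeastAtMost)
      moreover have "(Suc m - i, i) \<in> I"
        using iJ mJ \<open>i \<le> m\<close> by (auto simp: I_def J_def)
      ultimately show False using S(2) by auto
    qed
    then obtain k where k: "k \<in> J" "k < m" "u (Suc k) \<notin> S" by blast
    have SU: "S \<union> (U - S) = U" using S(1) by auto
    have "signed_cycle_sum x \<pi> S (U - S) = 0"
    proof (rule signed_cycle_sum_eq_0)
      show "u k \<in> S" "u m \<in> S" using SJ k mJ by auto
      show "u k \<noteq> u m" using k mJ u_eq[of k m] by (auto simp: J_def)
      show "\<pi> (u k) \<notin> S" "\<pi> (u m) \<notin> S" using k m_exit step by auto
      show "\<pi> permutes S \<union> (U - S)" using SU assms(2) by simp
    qed (use assms(1) SU finite_subset[of S U] in auto)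
    then show ?thesis by (simp add: W_def)
  qed

  \<comment> \<open>For the empty set the factor \<open>\<pi>\<close> is absorbed into the sum over
    all permutations of \<open>U\<close>.\<close>
  have W_empty: "W {} = pochhammer x n"
    using signed_cycle_sum_comp[of "{}" U id \<pi> x id] assms(1,2) signed_cycle_sum_id[OF assms(1), of x]
    by (simp add: W_def n_def permutes_id)

  have "(\<Sum>\<zeta> | \<zeta> permutes U \<and> cyclic_on \<zeta> U. x ^ num_cycles U (\<pi> \<circ> \<zeta>)) = (\<Sum>S\<in>Pow (U - {r}). W S)"
    unfolding W_def by (rule sum_cyclic_eq_signed_cycle_sums[OF assms(1) r])
  also have "\<dots> = (\<Sum>S\<in>insert {} (arc ` I). W S)"
    by (rule sum.mono_neutral_right) (use assms(1) arc_sub W_zero in auto)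
  also have "\<dots> = W {} + (\<Sum>p\<in>I. W (arc p))"
  proof -
    have "{} \<notin> arc ` I" using arc_sub by force
    then show ?thesis using finI sum.reindex[OF \<open>inj_on arc I\<close>, of W] by simp
  qed
  also have "(\<Sum>p\<in>I. W (arc p)) = (\<Sum>(s, i)\<in>I. - pochhammer (x - of_nat (s - 1)) (n - 1))"
    by (rule sum.cong) (auto simp: W_arc)
  also have "\<dots> = (\<Sum>s\<in>{1..<n}. \<Sum>i\<in>{1..n - s}. - pochhammer (x - of_nat (s - 1)) (n - 1))"
    unfolding I_def by (rule sum.Sigma[symmetric]) auto
  also have "W {} + \<dots> =
      pochhammer x n - (\<Sum>s\<in>{1..<n}. of_nat (n - s) * pochhammer (x - of_nat (s - 1)) (n - 1))"
    by (simp add: W_empty sum_negf)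
  finally show ?thesis .
qed

section \<open>Telescoping of rising factorials\<close>

text \<open>Both products contain \<open>pochhammer y m\<close>; the remaining factors
  \<open>y + m\<close> and \<open>y - 1\<close> differ by \<open>m + 1\<close>.\<close>

lemma pochhammer_diff_shift:
  fixes y :: "'b :: comm_ring_1"
  shows "pochhammer y (Suc m) - pochhammer (y - 1) (Suc m) = of_nat (Suc m) * pochhammer y m"
  using pochhammer_rec[of "y - 1" m] by (simp add: pochhammer_rec' algebra_simps)

text \<open>Multiplication by \<open>n\<close> turns the summands into weighted differences of
  \<open>?E\<close>, and summation by parts leaves the plain sum of the \<open>?E j\<close>.
  Multiplication by \<open>n + 1\<close> turns these into differences of \<open>?H\<close>, which
  telescope.\<close>

lemma pochhammer_double_telescope:
  fixes x :: "'b :: comm_ring_1"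
  assumes "n \<ge> 1"
  shows "of_nat (n * (n + 1)) * (pochhammer x n -
      (\<Sum>s\<in>{1..<n}. of_nat (n - s) * pochhammer (x - of_nat (s - 1)) (n - 1))) =
    pochhammer x (n + 1) - pochhammer (x - of_nat n) (n + 1)"
proof -
  obtain k where k: "n = Suc k" using assms by (cases n) auto
  let ?E = "\<lambda>j. pochhammer (x - of_nat j) n"
  let ?H = "\<lambda>j. pochhammer (x - of_nat j) (Suc n)"
  have E: "?E j - ?E (Suc j) = of_nat n * pochhammer (x - of_nat j) (n - 1)" for j
    using pochhammer_diff_shift[of "x - of_nat j" k] k by (simp add: algebra_simps)
  have H: "?H j - ?H (Suc j) = of_nat (Suc n) * ?E j" for j
    using pochhammer_diff_shift[of "x - of_nat j" n] by (simp add: algebra_simps)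
  \<comment> \<open>Summation by parts: increasing \<open>k\<close> by 1 raises every weight by 1,
    which adds one telescoping sum.\<close>
  have abel: "(\<Sum>j<k. of_nat (k - j) * (e j - e (Suc j))) = of_nat (Suc k) * e 0 - (\<Sum>j<Suc k. e j)"
    for e :: "nat \<Rightarrow> 'b" and k
  proof (induction k)
    case 0
    show ?case by simp
  next
    case (Suc k)
    have "(\<Sum>j<Suc k. of_nat (Suc k - j) * (e j - e (Suc j))) =
        (\<Sum>j<Suc k. of_nat (k - j) * (e j - e (Suc j))) + (\<Sum>j<Suc k. e j - e (Suc j))"
      unfolding sum.distrib[symmetric]
      by (intro sum.cong refl) (simp add: Suc_diff_le algebra_simps)
    also have "(\<Sum>j<Suc k. of_nat (k - j) * (e j - e (Suc j))) =
        of_nat (Suc k) * e 0 - (\<Sum>j<Suc k. e j)"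
      using Suc.IH by simp
    also have "(\<Sum>j<Suc k. e j - e (Suc j)) = e 0 - e (Suc k)"
      by (rule sum_lessThan_telescope')
    finally show ?case by (simp add: algebra_simps)
  qed
  have "(\<Sum>s\<in>{1..<n}. of_nat (n - s) * pochhammer (x - of_nat (s - 1)) (n - 1)) =
      (\<Sum>j<k. of_nat (k - j) * pochhammer (x - of_nat j) (n - 1))"
    by (rule sum.reindex_bij_witness[where i = Suc and j = "\<lambda>s. s - 1"]) (auto simp: k)
  then have "of_nat n * (\<Sum>s\<in>{1..<n}. of_nat (n - s) * pochhammer (x - of_nat (s - 1)) (n - 1)) =
      (\<Sum>j<k. of_nat (k - j) * (?E j - ?E (Suc j)))"
    unfolding E by (simp add: sum_distrib_left mult.left_commute)
  also have "\<dots> = of_nat n * pochhammer x n - (\<Sum>j<n. ?E j)"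
    using abel[of k ?E] by (simp add: k)
  finally have "of_nat n * (pochhammer x n -
      (\<Sum>s\<in>{1..<n}. of_nat (n - s) * pochhammer (x - of_nat (s - 1)) (n - 1))) = (\<Sum>j<n. ?E j)"
    (is "of_nat n * ?A = _")
    by (simp add: right_diff_distrib)
  moreover have "of_nat (Suc n) * (\<Sum>j<n. ?E j) = ?H 0 - ?H n"
    unfolding sum_distrib_left H[symmetric] by (rule sum_lessThan_telescope')
  moreover have "of_nat (n * (n + 1)) * ?A = of_nat (Suc n) * (of_nat n * ?A)"
    by (simp only: of_nat_mult Suc_eq_plus1 mult_ac)
  ultimately show ?thesis by simp
qed

section \<open>Stirling coefficients and the final identity\<close>

lemma coeff_pochhammer_X:
  "coeff (pochhammer (monom 1 1 :: int poly) m) k = int (stirling m k)"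
proof -
  have "pochhammer (monom 1 1 :: int poly) m = (\<Sum>i\<le>m. monom (int (stirling m i)) i)"
    unfolding stirling_pochhammer[symmetric]
    by (intro sum.cong refl) (simp add: monom_power of_nat_poly smult_monom)
  then show ?thesis by (cases "k \<le> m") (auto simp: coeff_sum)
qed

lemma coeff_pochhammer_minus_X:
  "coeff (pochhammer (- monom 1 1 :: int poly) m) k = (-1) ^ k * int (stirling m k)"
proof -
  have "pochhammer (- monom 1 1 :: int poly) m = (\<Sum>i\<le>m. monom ((-1) ^ i * int (stirling m i)) i)"
    unfolding stirling_pochhammer[symmetric]
    by (intro sum.cong refl)
      (simp add: monom_power of_nat_poly smult_monom minus_monom flip: power_minus)
  then show ?thesis by (cases "k \<le> m") (auto simp: coeff_sum)
qed

theorem theorem4p2: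
  fixes n :: nat and \<pi> :: "nat \<Rightarrow> nat"
  assumes "n \<ge> 1" and "\<pi> \<in> n_cycles n"
  shows "of_nat ((n + 1) choose 2) * F_poly n \<pi> =
    (\<Sum>k | 1 \<le> k \<and> k \<le> n + 1 \<and> k mod 2 = n mod 2.
       monom (int (stirling (n + 1) k)) ((k - 1) div 2))"
proof -
  let ?X = "monom 1 1 :: int poly"
  let ?b = "int ((n + 1) choose 2)"
  let ?c = "\<lambda>\<zeta>. num_cycles {1..n} (\<pi> \<circ> \<zeta>)"
  \<comment> \<open>\<open>Q\<close> records the full cycle count as exponent; the halved exponents
    of \<open>F_poly\<close> are introduced only after its coefficients are known.\<close>
  define Q where "Q = (\<Sum>\<zeta>\<in>n_cycles n. ?X ^ ?c \<zeta>)"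
  have "of_nat (n * (n + 1)) * Q = pochhammer ?X (n + 1) - pochhammer (?X - of_nat n) (n + 1)"
    using sum_cyclic_power_num_cycles[of "{1..n}" \<pi> ?X] pochhammer_double_telescope[OF assms(1), of ?X]
      assms(2)
    by (simp add: Q_def n_cycles_def)
  \<comment> \<open>Reversing the order of the \<open>n + 1\<close> factors and negating each one
    gives a rising factorial in \<open>- ?X\<close>.\<close>
  also have "pochhammer (?X - of_nat n) (n + 1) = (-1) ^ (n + 1) * pochhammer (- ?X) (n + 1)"
    using pochhammer_minus'[of ?X "n + 1"] by simp
  finally have Q: "of_nat (n * (n + 1)) * Q =
      pochhammer ?X (n + 1) - (-1) ^ (n + 1) * pochhammer (- ?X) (n + 1)" .
  have choose2: "int (n * (n + 1)) = 2 * ?b"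
  proof -
    have "(n + 1) choose 2 = (n + 1) * n div 2" by (simp add: choose_two)
    moreover have "even ((n + 1) * n)" by simp
    ultimately have "2 * ((n + 1) choose 2) = n * (n + 1)" by (simp add: mult.commute)
    then show ?thesis by (metis of_nat_mult of_nat_numeral)
  qed
  \<comment> \<open>The two products contribute the same Stirling number with relative sign
    \<open>(-1) ^ (n + k)\<close>, hence twice it or zero. The factor 2 cancels against
    \<open>n * (n + 1) = 2 * ?b\<close>.\<close>
  have coeff_Q: "?b * coeff Q k = (if k mod 2 = n mod 2 then int (stirling (n + 1) k) else 0)" for k
  proof -
    have sgn: "(-1 :: int poly) ^ m = monom ((-1) ^ m) 0" for m
      by (induction m) (simp_all add: monom_0 one_pCons)
    have "int (n * (n + 1)) * coeff Q k =
        int (stirling (n + 1) k) - (-1) ^ (n + 1) * ((-1) ^ k * int (stirling (n + 1) k))"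
      using arg_cong[OF Q, of "\<lambda>p. coeff p k"]
      by (simp only: coeff_diff of_nat_poly coeff_pochhammer_X coeff_pochhammer_minus_X sgn
          monom_0 coeff_smult mult_pCons_left pCons_0_0 add_0_right mult_zero_left)
    then have "2 * (?b * coeff Q k) = (1 + (-1) ^ (n + k)) * int (stirling (n + 1) k)"
      unfolding choose2 by (simp add: algebra_simps power_add)
    moreover have "(-1 :: int) ^ (n + k) = (if k mod 2 = n mod 2 then 1 else -1)"
    proof -
      have "even (n + k) \<longleftrightarrow> k mod 2 = n mod 2" by presburger
      then show ?thesis unfolding minus_one_power_iff by (rule if_cong) simp_all
    qed
    ultimately show ?thesis by auto
  qed
  \<comment> \<open>The cycles \<open>\<zeta>\<close> are grouped by \<open>?c \<zeta>\<close>,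
    which is at most \<open>n\<close> and so lies within the summation range.\<close>
  have "F_poly n \<pi> = (\<Sum>k\<le>n + 1. monom (coeff Q k) ((k - 1) div 2))"
  proof -
    have le: "?c \<zeta> \<le> n" for \<zeta>
      using card_image_le[of "{1..n}" "orbit (\<pi> \<circ> \<zeta>)"] by (simp add: num_cycles_def)
    have "coeff Q k = (\<Sum>\<zeta>\<in>n_cycles n. if ?c \<zeta> = k then 1 else 0)" for k
      by (simp add: Q_def coeff_sum monom_power)
    then have "(\<Sum>k\<le>n + 1. monom (coeff Q k) ((k - 1) div 2)) =
        (\<Sum>k\<le>n + 1. \<Sum>\<zeta>\<in>n_cycles n. if ?c \<zeta> = k then monom 1 ((k - 1) div 2) else 0)"
      by (simp add: monom_sum if_distrib[of "\<lambda>c. monom c _"] cong: if_cong)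
    also have "\<dots> = (\<Sum>\<zeta>\<in>n_cycles n. \<Sum>k\<le>n + 1. if ?c \<zeta> = k then monom 1 ((k - 1) div 2) else 0)"
      by (rule sum.swap)
    also have "\<dots> = F_poly n \<pi>"
      unfolding F_poly_def
    proof (intro sum.cong refl)
      fix \<zeta>
      show "(\<Sum>k\<le>n + 1. if ?c \<zeta> = k then monom 1 ((k - 1) div 2) else 0) =
          (monom 1 ((?c \<zeta> - 1) div 2) :: int poly)"
        using le[of \<zeta>] by (subst sum.delta') auto
    qed
    finally show ?thesis by simp
  qed
  then have "of_nat ((n + 1) choose 2) * F_poly n \<pi> =
      (\<Sum>k\<le>n + 1. monom (?b * coeff Q k) ((k - 1) div 2))"
    by (simp only: sum_distrib_left) (simp add: of_nat_poly smult_monom)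
  also have "\<dots> = (\<Sum>k | 1 \<le> k \<and> k \<le> n + 1 \<and> k mod 2 = n mod 2.
       monom (int (stirling (n + 1) k)) ((k - 1) div 2))"
    unfolding coeff_Q
  \<comment> \<open>Terms of the wrong parity vanish, and so does \<open>k = 0\<close>, because
    \<open>stirling (n + 1) 0 = 0\<close>.\<close>
  proof (rule sum.mono_neutral_cong_right)
    show "\<forall>k\<in>{..n + 1} - {k. 1 \<le> k \<and> k \<le> n + 1 \<and> k mod 2 = n mod 2}.
        monom (if k mod 2 = n mod 2 then int (stirling (n + 1) k) else 0) ((k - 1) div 2) = 0"
    proof
      fix k assume "k \<in> {..n + 1} - {k. 1 \<le> k \<and> k \<le> n + 1 \<and> k mod 2 = n mod 2}"
      then have "k = 0 \<or> k mod 2 \<noteq> n mod 2" by auto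
      then show "monom (if k mod 2 = n mod 2 then int (stirling (n + 1) k) else 0) ((k - 1) div 2) = 0"
        by auto
    qed
  qed auto
  finally show ?thesis .
qed

end
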